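(* Let $n\ge 1$ and $m\ge 0$ be integers, let $M$ be a measure space, let $J_1,J_2,\ldots,J_n$ be integrable real-valued functions on $M$, and let $C$ be a non-zero constant. Suppose that $$\int_M (v_1J_1+v_2J_2+\cdots+v_nJ_n)^{2m}=C$$ for all $(v_1,v_2,\ldots,v_n)\in\mathbb{R}^n$ with $v_1^2+v_2^2+\cdots+v_n^2=1$. Then $$\int_M (J_1^2+J_2^2+\cdots+J_n^2)^m=I_{m,n}\,C,$$ where $$I_{m,n}=\frac{\Gamma\left(\frac12\right)\Gamma\left(m+\frac n2\right)}{\Gamma\left(m+\frac12\right)\Gamma\left(\frac n2\right)},$$ and $I_{m,n}$ is a rational number (depending only on $m$ and $n$).
   Context: Integrals are taken with respect to the measure of $M$. $\Gamma$ denotes Euler's Gamma function. The zeroth power of any real number (including $0$) is $1$. *)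

theory Defs
  imports "HOL-Analysis.Analysis"
begin

definition I_const :: "nat \<Rightarrow> nat \<Rightarrow> real" where
  "I_const m n =
     (Gamma (1/2) * Gamma (real m + real n / 2)) / (Gamma (real m + 1/2) * Gamma (real n / 2))"

end

theory Submission
  imports Defs
begin

text \<open>
  Homogeneity turns the hypothesis into \<open>\<integral> (v \<bullet> J)^(2m) = C |v|^(2m)\<close> for all \<open>v\<close>. Applying the
  Laplacian in \<open>v\<close> repeatedly yields \<open>\<integral> |J|^(2k) (v \<bullet> J)^(2p) = C (I\<^sub>m / I\<^sub>p) |v|^(2p)\<close> for \<open>k + p = m\<close>,
  and \<open>p = 0\<close> is the claim. No differentiation under the integral is needed: replacing
  \<open>v\<close> by \<open>v + t e\<^sub>i\<close> gives an identity of polynomials in \<open>t\<close>, whose coefficients at \<open>t\<^sup>2\<close> are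
  compared and summed over \<open>i\<close>.
\<close>

section \<open>Recursion, positivity and rationality of \<open>I_const\<close>\<close>

lemma I_const_0:
  assumes "n \<ge> 1"
  shows "I_const 0 n = 1"
proof -
  have "Gamma (1 / 2 :: real) > 0" "Gamma (real n / 2) > 0"
    using assms by (intro Gamma_real_pos; simp)+
  then have "Gamma (1 / 2 :: real) \<noteq> 0" "Gamma (real n / 2) \<noteq> 0"
    by linarith+
  then show ?thesis
    by (simp add: I_const_def)
qed

lemma I_const_pos:
  assumes "n \<ge> 1"
  shows "I_const m n > 0"
  unfolding I_const_def using assms
  by (intro divide_pos_pos mult_pos_pos Gamma_real_pos) (auto intro: add_nonneg_pos)

text \<open>Gamma(z + 1) = z Gamma(z) is applied once in the numerator and once in the denominator.
  The resulting factor is the one that \<open>laplacian_step\<close> produces, and it is rational,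
  so rationality follows by induction on m.\<close>

lemma I_const_Suc:
  assumes "n \<ge> 1"
  shows "I_const (Suc m) n = I_const m n * ((2 * real m + real n) / (2 * real m + 1))"
proof -
  have shift: "Gamma (z + 1) = z * Gamma z" if "z > 0" for z :: real
    using that by (intro Gamma_plus1) (auto elim!: nonpos_Ints_cases)
  have "Gamma (real (Suc m) + real n / 2) = (real m + real n / 2) * Gamma (real m + real n / 2)"
    using shift[of "real m + real n / 2"] assms by (simp add: algebra_simps)
  moreover have "Gamma (real (Suc m) + 1 / 2) = (real m + 1 / 2) * Gamma (real m + 1 / 2)"
    using shift[of "real m + 1 / 2"] by (simp add: algebra_simps)
  moreover have "(2 * real m + real n) / (2 * real m + 1) = (real m + real n / 2) / (real m + 1 / 2)"
    by (simp add: divide_simps) (simp add: algebra_simps)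
  ultimately show ?thesis
    unfolding I_const_def by (simp only: times_divide_times_eq mult_ac)
qed

lemma I_const_Rats:
  assumes "n \<ge> 1"
  shows "I_const m n \<in> \<rat>"
proof (induction m)
  case 0
  then show ?case using I_const_0[OF assms] by simp
next
  case (Suc m)
  then show ?case unfolding I_const_Suc[OF assms]
    by (intro Rats_mult Rats_divide Rats_add) auto
qed

section \<open>Polynomial coefficients and a power-sum bound\<close>

lemma coeff_quadratic_power:
  fixes a b :: real
  shows "coeff ([:a, b, 1:] ^ p) 2
    = real p * a ^ (p - 1) + real p * (real p - 1) / 2 * b\<^sup>2 * a ^ (p - 2)"
proof -
  \<comment> \<open>Multiplication by a + b t + t^2 builds the new coefficient at t^2 from the three
    lowest old ones, so those at 1 and t are needed as well.\<close>
  have c0: "coeff ([:a, b, 1:] ^ p) 0 = a ^ p" for p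
    by (simp add: coeff_0_power)
  have c1: "coeff ([:a, b, 1:] ^ p) 1 = b * real p * a ^ (p - 1)" for p
  proof (induction p)
    case (Suc p)
    then show ?case
      by (cases p) (auto simp: c0 algebra_simps)
  qed simp
  show ?thesis
  proof (induction p)
    case (Suc p)
    have "coeff ([:a, b, 1:] ^ Suc p) 2 = a * coeff ([:a, b, 1:] ^ p) 2
        + b * coeff ([:a, b, 1:] ^ p) 1 + coeff ([:a, b, 1:] ^ p) 0"
      by (simp add: numeral_2_eq_2)
    also have "\<dots> = real (Suc p) * a ^ (Suc p - 1)
        + real (Suc p) * (real (Suc p) - 1) / 2 * b\<^sup>2 * a ^ (Suc p - 2)"
    proof -
      \<comment> \<open>For small p the exponents p - 1 and p - 2 are truncated at 0; the factors p
        and p (p - 1) vanish exactly there.\<close>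
      consider "p = 0" | "p = 1" | q where "p = Suc (Suc q)"
        by (metis One_nat_def old.nat.exhaust)
      then show ?thesis
        unfolding Suc c0 c1 by cases (simp_all add: field_simps power2_eq_square)
    qed
    finally show ?case .
  qed simp
qed

text \<open>By the binomial theorem the integral is itself a polynomial in t with moments as
  coefficients. Real polynomials that agree at every t have equal coefficients; this takes the place
  of differentiating under the integral.\<close>

lemma coeff_binomial_integral:
  fixes G f g :: "'a \<Rightarrow> real"
  assumes int: "\<And>j. j \<le> N \<Longrightarrow> integrable M (\<lambda>x. G x * f x ^ (N - j) * g x ^ j)"
    and eq: "\<And>t. (\<integral>x. G x * (f x + t * g x) ^ N \<partial>M) = poly P t"
    and "k \<le> N"
  shows "real (N choose k) * (\<integral>x. G x * f x ^ (N - k) * g x ^ k \<partial>M) = coeff P k"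
proof -
  define A where "A j = (\<integral>x. G x * f x ^ (N - j) * g x ^ j \<partial>M)" for j
  have "poly (\<Sum>j\<le>N. monom (real (N choose j) * A j) j) t = poly P t" for t
  proof -
    have "G x * (f x + t * g x) ^ N
        = (\<Sum>j\<le>N. (real (N choose j) * t ^ j) * (G x * f x ^ (N - j) * g x ^ j))" for x
      unfolding add.commute[of "f x"]
      by (simp add: binomial_ring sum_distrib_left power_mult_distrib mult_ac)
    then have "(\<integral>x. G x * (f x + t * g x) ^ N \<partial>M)
        = (\<Sum>j\<le>N. (real (N choose j) * t ^ j) * A j)"
      using int by (simp add: A_def)
    with eq[of t] show ?thesis
      by (simp add: poly_sum poly_monom mult_ac)
  qed
  then have "(\<Sum>j\<le>N. monom (real (N choose j) * A j) j) = P"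
    by (simp add: poly_eq_poly_eq_iff[symmetric] fun_eq_iff)
  then have "coeff P k = (\<Sum>j\<le>N. if j = k then real (N choose j) * A j else 0)"
    by (auto simp: coeff_sum)
  also have "\<dots> = real (N choose k) * A k"
    using \<open>k \<le> N\<close> by simp
  finally show ?thesis by (simp add: A_def)
qed

text \<open>Every summand is at most the largest one, and the power of the largest is one term of
  the right-hand sum. This crude constant suffices for domination in
  \<open>integrable_sq_power\<close>.\<close>

lemma power_sum_le_sum_power:
  fixes f :: "'b \<Rightarrow> real"
  assumes "finite S" "S \<noteq> {}" and nonneg: "\<And>i. i \<in> S \<Longrightarrow> f i \<ge> 0"
  shows "(\<Sum>i\<in>S. f i) ^ m \<le> real (card S) ^ m * (\<Sum>i\<in>S. f i ^ m)"
proof -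
  have "Max (f ` S) \<in> f ` S"
    using assms by (intro Max_in) auto
  then obtain k where k: "k \<in> S" "f k = Max (f ` S)" by auto
  have "(\<Sum>i\<in>S. f i) \<le> real (card S) * f k"
    using assms k by (intro sum_bounded_above) auto
  then have "(\<Sum>i\<in>S. f i) ^ m \<le> real (card S) ^ m * f k ^ m"
    unfolding power_mult_distrib[symmetric] by (intro power_mono sum_nonneg nonneg)
  also have "\<dots> \<le> real (card S) ^ m * (\<Sum>i\<in>S. f i ^ m)"
    using assms k by (intro mult_left_mono member_le_sum) auto
  finally show ?thesis .
qed

section \<open>Setting: linear forms and squared norms\<close>

locale constant_directional_moment =
  fixes M :: "'a measure" and n m :: nat and J :: "nat \<Rightarrow> 'a \<Rightarrow> real" and C :: real
  assumes n: "n \<ge> 1"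
    and meas [measurable]: "\<And>i. i \<in> {1..n} \<Longrightarrow> J i \<in> borel_measurable M"
    \<comment> \<open>\<open>has_bochner_integral\<close> asserts integrability along with the
      value; all later integrability is derived from it.\<close>
    and moment: "\<And>v :: nat \<Rightarrow> real. (\<Sum>i=1..n. (v i)\<^sup>2) = 1 \<Longrightarrow>
      has_bochner_integral M (\<lambda>x. (\<Sum>i=1..n. v i * J i x) ^ (2 * m)) C"
begin

definition sq :: "'a \<Rightarrow> real" where
  "sq x = (\<Sum>i=1..n. (J i x)\<^sup>2)"

definition lin :: "(nat \<Rightarrow> real) \<Rightarrow> 'a \<Rightarrow> real" where
  "lin v x = (\<Sum>i=1..n. v i * J i x)"

definition nsq :: "(nat \<Rightarrow> real) \<Rightarrow> real" where
  "nsq v = (\<Sum>i=1..n. (v i)\<^sup>2)"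

lemma sq_nonneg: "sq x \<ge> 0"
  by (simp add: sq_def sum_nonneg)

lemma nsq_nonneg: "nsq v \<ge> 0"
  by (simp add: nsq_def sum_nonneg)

lemma measurable_sq [measurable]: "sq \<in> borel_measurable M"
  unfolding sq_def[abs_def] by (intro borel_measurable_sum borel_measurable_power meas)

lemma measurable_lin [measurable]: "lin v \<in> borel_measurable M"
  unfolding lin_def[abs_def] by (intro borel_measurable_sum borel_measurable_times meas) auto

text \<open>The function \<open>\<lambda>j. of_bool (j = i)\<close> serves as the i-th standard
  basis vector.\<close>

lemma lin_unit: "i \<in> {1..n} \<Longrightarrow> lin (\<lambda>j. of_bool (j = i)) x = J i x"
  by (simp add: lin_def of_bool_def if_distrib[of "\<lambda>c. c * _"] cong: if_cong)

lemma nsq_unit: "i \<in> {1..n} \<Longrightarrow> nsq (\<lambda>j. of_bool (j = i)) = 1"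
  by (simp add: nsq_def of_bool_def if_distrib[of "\<lambda>c. c\<^sup>2"] cong: if_cong)

lemma lin_shift:
  "i \<in> {1..n} \<Longrightarrow> lin (\<lambda>j. v j + t * of_bool (j = i)) x = lin v x + t * J i x"
  using lin_unit[of i x]
  by (simp add: lin_def distrib_right sum.distrib mult.assoc flip: sum_distrib_left)

lemma nsq_shift:
  assumes "i \<in> {1..n}"
  shows "nsq (\<lambda>j. v j + t * of_bool (j = i)) = nsq v + 2 * t * v i + t\<^sup>2"
proof -
  have "(v j + t * of_bool (j = i))\<^sup>2 = (v j)\<^sup>2 + (if j = i then 2 * t * v i + t\<^sup>2 else 0)" for j
    by (simp add: power2_eq_square algebra_simps)
  then show ?thesis
    using assms by (simp add: nsq_def sum.distrib)
qed

section \<open>Pointwise bounds and integrability\<close>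

lemma abs_component_le: "i \<in> {1..n} \<Longrightarrow> \<bar>J i x\<bar> \<le> sqrt (sq x)"
  unfolding sq_def by (intro real_le_rsqrt) (auto intro: member_le_sum)

lemma abs_lin_le: "\<bar>lin v x\<bar> \<le> sqrt (nsq v) * sqrt (sq x)"
  unfolding lin_def nsq_def sq_def real_sqrt_mult[symmetric]
  by (intro real_le_rsqrt) (simp add: Cauchy_Schwarz_ineq_sum)

text \<open>\<open>moment\<close> at the basis vectors makes each \<open>J i x ^ (2 * m)\<close>
  integrable, and their sum dominates up to a constant.\<close>

lemma integrable_sq_power: "integrable M (\<lambda>x. sq x ^ m)"
proof (rule Bochner_Integration.integrable_bound)
  have "integrable M (\<lambda>x. (J i x) ^ (2 * m))" if "i \<in> {1..n}" for i
    using moment[of "\<lambda>j. of_bool (j = i)"] nsq_unit[OF that] lin_unit[OF that]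
    by (simp add: nsq_def lin_def has_bochner_integral_iff)
  then show "integrable M (\<lambda>x. real n ^ m * (\<Sum>i=1..n. (J i x) ^ (2 * m)))"
    by (intro integrable_mult_right integrable_sum) auto
  show "AE x in M. norm (sq x ^ m) \<le> norm (real n ^ m * (\<Sum>i=1..n. (J i x) ^ (2 * m)))"
  proof (intro AE_I2)
    fix x
    have "sq x ^ m \<le> real n ^ m * (\<Sum>i=1..n. (J i x) ^ (2 * m))"
      using power_sum_le_sum_power[of "{1..n}" "\<lambda>i. (J i x)\<^sup>2" m] n
      by (simp add: sq_def power_mult)
    then show "norm (sq x ^ m) \<le> norm (real n ^ m * (\<Sum>i=1..n. (J i x) ^ (2 * m)))"
      using sq_nonneg[of x] by simp
  qed
qed measurable

text \<open>The integrand has total degree 2m in J. Bounding each factor by a power of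
  \<open>sqrt (sq x)\<close>, with Cauchy-Schwarz for \<open>lin\<close>, leaves a constant times
  \<open>sq x ^ m\<close>.\<close>

lemma integrable_mixed:
  assumes "i \<in> {1..n}" "2 * k + p + q = 2 * m"
  shows "integrable M (\<lambda>x. sq x ^ k * lin v x ^ p * J i x ^ q)"
proof (rule Bochner_Integration.integrable_bound)
  show "integrable M (\<lambda>x. sqrt (nsq v) ^ p * sq x ^ m)"
    by (intro integrable_mult_right integrable_sq_power)
  show "(\<lambda>x. sq x ^ k * lin v x ^ p * J i x ^ q) \<in> borel_measurable M"
    using meas[OF assms(1)] by measurable
  show "AE x in M. norm (sq x ^ k * lin v x ^ p * J i x ^ q) \<le> norm (sqrt (nsq v) ^ p * sq x ^ m)"
  proof (intro AE_I2)
    fix x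
    have sq: "sq x = sqrt (sq x) ^ 2"
      using sq_nonneg by simp
    have "\<bar>sq x\<bar> ^ k * \<bar>lin v x\<bar> ^ p * \<bar>J i x\<bar> ^ q
        \<le> sqrt (sq x) ^ (2 * k) * (sqrt (nsq v) * sqrt (sq x)) ^ p * sqrt (sq x) ^ q"
      using sq_nonneg[of x] nsq_nonneg[of v] abs_lin_le abs_component_le[OF assms(1)]
      by (intro mult_mono power_mono) (auto simp: power_mult)
    also have "\<dots> = sqrt (nsq v) ^ p * sqrt (sq x) ^ (2 * m)"
      unfolding assms(2)[symmetric] by (simp add: power_add power_mult_distrib mult_ac)
    also have "\<dots> = sqrt (nsq v) ^ p * sq x ^ m"
      using sq by (simp add: power_mult)
    finally show "norm (sq x ^ k * lin v x ^ p * J i x ^ q) \<le> norm (sqrt (nsq v) ^ p * sq x ^ m)"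
      using sq_nonneg[of x] nsq_nonneg[of v] by (simp add: abs_mult power_abs)
  qed
qed

section \<open>Moments for all v and iteration of the Laplacian\<close>

lemma integral_lin_power: "(\<integral>x. lin v x ^ (2 * m) \<partial>M) = C * nsq v ^ m"
proof (cases "nsq v = 0")
  case True
  then have v: "lin v x = 0" for x
    by (simp add: nsq_def lin_def sum_nonneg_eq_0_iff)
  show ?thesis
  \<comment> \<open>For v = 0 and m = 0 the convention 0^0 = 1 leaves the integral of 1, which
    equals C by \<open>moment\<close> at a basis vector; n \<ge> 1 supplies one.\<close>
  proof (cases "m = 0")
    case True
    with moment[of "\<lambda>j. of_bool (j = 1)"] nsq_unit[of 1] n show ?thesis
      by (simp add: nsq_def has_bochner_integral_iff)
  qed (simp add: v \<open>nsq v = 0\<close> zero_power)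
next
  case False
  define r where "r = sqrt (nsq v)"
  have r: "r > 0" "r\<^sup>2 = nsq v"
    using False nsq_nonneg[of v] by (auto simp: r_def)
  define w where "w i = v i / r" for i
  have "nsq w = 1"
    using r False by (simp add: nsq_def w_def power_divide flip: sum_divide_distrib)
  with moment[of w] have "(\<integral>x. lin w x ^ (2 * m) \<partial>M) = C"
    by (simp add: nsq_def lin_def has_bochner_integral_iff)
  moreover have "lin v x ^ (2 * m) = nsq v ^ m * lin w x ^ (2 * m)" for x
  proof -
    have "lin v x = r * lin w x"
      using r by (simp add: lin_def w_def flip: sum_divide_distrib)
    then show ?thesis
      using r by (simp add: power_mult power_mult_distrib)
  qed
  ultimately show ?thesis by simp
qed

text \<open>Comparing coefficients at t^2 along each basis direction and summing applies half the
  Laplacian in v to \<open>eq\<close>. The left side becomes (p + 1)(2p + 1) times the wanted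
  integral, the right side c (p + 1)(2p + n) |v|^(2p).\<close>

lemma laplacian_step:
  assumes eq: "\<And>v. (\<integral>x. sq x ^ k * lin v x ^ (2 * Suc p) \<partial>M) = c * nsq v ^ Suc p"
    and m: "k + Suc p = m"
  shows "(\<integral>x. sq x ^ Suc k * lin v x ^ (2 * p) \<partial>M)
    = c * ((2 * real p + real n) / (2 * real p + 1)) * nsq v ^ p"
proof -
  define A where "A i = (\<integral>x. sq x ^ k * lin v x ^ (2 * p) * (J i x)\<^sup>2 \<partial>M)" for i
  have A: "(real p + 1) * (2 * real p + 1) * A i
      = c * ((real p + 1) * nsq v ^ p + 2 * (real p + 1) * real p * (v i)\<^sup>2 * nsq v ^ (p - 1))"
    if i: "i \<in> {1..n}" for i
  proof -
    have "real (2 * Suc p choose 2)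
        * (\<integral>x. sq x ^ k * lin v x ^ (2 * Suc p - 2) * J i x ^ 2 \<partial>M)
      = coeff (smult c ([:nsq v, 2 * v i, 1:] ^ Suc p)) 2"
    proof (rule coeff_binomial_integral)
      show "(\<integral>x. sq x ^ k * (lin v x + t * J i x) ^ (2 * Suc p) \<partial>M)
        = poly (smult c ([:nsq v, 2 * v i, 1:] ^ Suc p)) t" for t
        using eq[of "\<lambda>j. v j + t * of_bool (j = i)"]
        unfolding lin_shift[OF i] nsq_shift[OF i] poly_smult poly_power
        by (simp add: power2_eq_square algebra_simps)
    qed (use m in \<open>auto intro!: integrable_mixed[OF i]\<close>)
    moreover have "real (2 * Suc p choose 2) = (real p + 1) * (2 * real p + 1)"
      by (simp add: choose_two field_simps)
    ultimately show ?thesis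
      unfolding coeff_smult coeff_quadratic_power by (simp add: A_def add_ac)
  qed
  have "(\<integral>x. sq x ^ Suc k * lin v x ^ (2 * p) \<partial>M) = (\<Sum>i=1..n. A i)"
  proof -
    have "sq x ^ Suc k * lin v x ^ (2 * p)
        = (\<Sum>i=1..n. sq x ^ k * lin v x ^ (2 * p) * (J i x)\<^sup>2)" for x
      by (simp add: sq_def flip: sum_distrib_left)
    then show ?thesis
      unfolding A_def using m by (subst Bochner_Integration.integral_sum[symmetric])
        (auto intro!: integrable_mixed)
  qed
  moreover have "(real p + 1) * (2 * real p + 1) * (\<Sum>i=1..n. A i)
      = (real p + 1) * (c * (2 * real p + real n) * nsq v ^ p)"
  proof -
    have "(real p + 1) * (2 * real p + 1) * (\<Sum>i=1..n. A i)
      = (\<Sum>i=1..n. c * ((real p + 1) * nsq v ^ p + 2 * (real p + 1) * real p * (v i)\<^sup>2 * nsq v ^ (p - 1)))"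
      unfolding sum_distrib_left by (intro sum.cong A) auto
    also have "\<dots> = c * (real n * ((real p + 1) * nsq v ^ p)
        + 2 * (real p + 1) * real p * nsq v * nsq v ^ (p - 1))"
      by (simp add: nsq_def sum.distrib flip: sum_distrib_left sum_distrib_right)
    \<comment> \<open>The split on p is needed because \<open>nsq v * nsq v ^ (p - 1)\<close> is
      \<open>nsq v ^ p\<close> only for p > 0; at p = 0 the factor p removes that term.\<close>
    also have "\<dots> = (real p + 1) * (c * (2 * real p + real n) * nsq v ^ p)"
      by (cases p) (simp_all add: algebra_simps)
    finally show ?thesis .
  qed
  then have "(2 * real p + 1) * (\<Sum>i=1..n. A i) = c * (2 * real p + real n) * nsq v ^ p"
    unfolding mult.assoc[of "real p + 1"] mult_cancel_left by linarith
  ultimately show ?thesis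
    by (simp add: field_simps)
qed

text \<open>The factors from \<open>laplacian_step\<close> telescope: by \<open>I_const_Suc\<close>
  each is the ratio of consecutive constants, starting from ratio 1 at p = m. Both p and v stay
  arbitrary, since a step uses the identity at p + 1 for every v.\<close>

lemma integral_mixed:
  assumes "k + p = m"
  shows "(\<integral>x. sq x ^ k * lin v x ^ (2 * p) \<partial>M) = C * (I_const m n / I_const p n) * nsq v ^ p"
  using assms
proof (induction k arbitrary: p v)
  case 0
  then show ?case
    using integral_lin_power[of v] I_const_pos[OF n, of m] by simp
next
  case (Suc k)
  have "(\<integral>x. sq x ^ Suc k * lin v x ^ (2 * p) \<partial>M)
    = C * (I_const m n / I_const (Suc p) n) * ((2 * real p + real n) / (2 * real p + 1)) * nsq v ^ p"
    using Suc by (intro laplacian_step) auto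
  also have "\<dots> = C * (I_const m n / I_const p n) * nsq v ^ p"
    using n I_const_pos[OF n, of p] unfolding I_const_Suc[OF n] by (simp add: divide_simps)
  finally show ?case .
qed

lemma has_bochner_integral_sq_power:
  "has_bochner_integral M (\<lambda>x. sq x ^ m) (I_const m n * C)"
  \<comment> \<open>At p = 0 both powers involving v equal 1, so the zero vector is just a
    convenient choice.\<close>
  using integral_mixed[of m 0 "\<lambda>_. 0"] integrable_sq_power I_const_0[OF n]
  by (simp add: has_bochner_integral_iff mult.commute)

end

theorem theorem1:
  fixes n m :: nat and M :: "'a measure" and J :: "nat \<Rightarrow> 'a \<Rightarrow> real" and C :: real
  assumes "n \<ge> 1"
    and "\<And>i. i \<in> {1..n} \<Longrightarrow> integrable M (J i)"
    and "C \<noteq> 0"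
    and "\<And>v :: nat \<Rightarrow> real. (\<Sum>i=1..n. (v i)\<^sup>2) = 1 \<Longrightarrow>
           has_bochner_integral M (\<lambda>x. (\<Sum>i=1..n. v i * J i x) ^ (2 * m)) C"
  shows "has_bochner_integral M (\<lambda>x. (\<Sum>i=1..n. (J i x)\<^sup>2) ^ m) (I_const m n * C) \<and>
         I_const m n \<in> \<rat>"
proof -
  interpret constant_directional_moment M n m J C
    by unfold_locales (use assms in auto)
  show ?thesis
    using has_bochner_integral_sq_power I_const_Rats[OF assms(1)] by (simp add: sq_def)
qed

end
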